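(* Let $\mathcal{G}_{\rm dist}$ be the distributed game described in the context. Suppose that there exist measurable functions $F:[0,T]\times\mathbb{R}^{n_x}\times\mathbb{R}^{n_a}\to\mathbb{R}$, $G:\mathbb{R}^{n_x}\to\mathbb{R}$, $U_{f_i}:[0,T]\times\prod_{j\neq i}\mathbb{R}^{n_j}\times\prod_{j\ne i}\mathbb{R}^{k_j}\to\mathbb{R}$ and $U_{g_i}:\prod_{j\ne i}\mathbb{R}^{n_j}\to\mathbb{R}$, $i\in I_N$, such that for all $i\in I_N$ and $(t,x,a)\in[0,T]\times\mathbb{R}^{n_x}\times\mathbb{R}^{n_a}$, $$f_i(t,x,a)=F(t,x,a)+U_{f_i}(t,x_{-i},a_{-i}),\qquad g_i(x)=G(x)+U_{g_i}(x_{-i}),$$ with $x_{-i}=(x_j)_{j\ne i}$ and $a_{-i}=(a_j)_{j\neq i}$. Then the distributed game $\mathcal{G}_{\rm dist}$ is a Markov potential game, with a potential function $\Phi:[0,T]\times\mathbb{R}^{n_x}\times\pi^{(N)}_{\rm dist}\to\mathbb{R}$ defined by $$\Phi^{t,x}(\phi)=\mathbb{E}^{\mathbb{P}}\left[\int_t^T F(s,X_s^{t,x,\phi},\alpha_s^{t,x,\phi})\,\mathrm{d}s+G(X_T^{t,x,\phi})\right],$$ with $X^{t,x,\phi}$ and $\alpha^{t,x,\phi}$ the joint state and control processes defined in the context.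
   Context: Distributed game $\mathcal{G}_{\rm dist}$. Let $T>0$, $N\in\mathbb{N}$, $(n_i)_{i=1}^N,(k_i)_{i=1}^N\subset\mathbb{N}$, $I_N=\{1,\dots,N\}$ (the set of players), $\mathcal{S}=[0,T]\times\prod_{i\in I_N}\mathbb{R}^{n_i}$ (the state space), $A_i$ a Borel set in $\mathbb{R}^{k_i}$ (player $i$'s action set), $n_x=\sum_{i=1}^N n_i$, $n_a=\sum_{i=1}^N k_i$. The set of distributed policy profiles is $\pi^{(N)}_{\rm dist}=\prod_{i\in I_N}\pi_i^{\rm dist}$, where $\pi_i^{\rm dist}$ contains measurable functions $\phi_i:[0,T]\times\mathbb{R}^{n_i}\to A_i$ such that $\sup_{(t,x_i)\in[0,T]\times\mathbb{R}^{n_i}}\frac{|\phi_i(t,x_i)|}{1+|x_i|}<\infty$ and, for all $(t,x_i)\in[0,T]\times\mathbb{R}^{n_i}$, player $i$'s state dynamics $$\mathrm{d}X_s^i=b_i(s,X_s^i,\phi_i(s,X_s^i))\,\mathrm{d}s+\sigma_i(s,X_s^i,\phi_i(s,X_s^i))\,\mathrm{d}W_s,\quad s\in[t,T];\qquad X_t^i=x_i,$$ admits a unique square-integrable weak solution $X^{t,x_i,\phi_i}$ on a probability space $(\Omega,\mathcal{F},\mathbb{P})$. Here $(b_i,\sigma_i):[0,T]\times\mathbb{R}^{n_i}\times\mathbb{R}^{k_i}\to\mathbb{R}^{n_i}\times\mathbb{R}^{n_i\times n_w}$ are given measurable functions, and $W$ is an $n_w$-dimensional Brownian motion on $(\Omega,\mathcal{F},\mathbb{P})$.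 For each $t\in[0,T]$, $x=(x_i)_{i\in I_N}\in\prod_{i\in I_N}\mathbb{R}^{n_i}$ and $\phi=(\phi_i)_{i\in I_N}\in\pi^{(N)}_{\rm dist}$, let $X^{t,x,\phi}=(X^{t,x_i,\phi_i})_{i\in I_N}$ be the joint state process and $\alpha^{t,x,\phi}=(\phi_i(\cdot,X^{t,x_i,\phi_i}))_{i\in I_N}$ the joint control process. Player $i$'s value function $V_i:[0,T]\times\mathbb{R}^{n_x}\times\pi^{(N)}_{\rm dist}\to\mathbb{R}$ is $$V_i^{t,x}(\phi)=\mathbb{E}^{\mathbb{P}}\left[\int_t^Tf_i(s,X_s^{t,x,\phi},\alpha_s^{t,x,\phi})\,\mathrm{d}s+g_i(X_T^{t,x,\phi})\right],$$ where $f_i:[0,T]\times\mathbb{R}^{n_x}\times\mathbb{R}^{n_a}\to\mathbb{R}$ is a measurable function with $\sup_{(t,x,a)\in[0,T]\times\mathbb{R}^{n_x}\times\mathbb{R}^{n_a}}\frac{|f_i(t,x,a)|}{1+|x|^2+|a|^2}<\infty$ and $g_i:\mathbb{R}^{n_x}\to\mathbb{R}$ is a measurable function with $\sup_{x\in\mathbb{R}^{n_x}}\frac{|g_i(x)|}{1+|x|^2}<\infty$. Markov potential game. $\mathcal{G}_{\rm dist}$ is a Markov potential game with potential function $\Phi:[0,T]\times\mathbb{R}^{n_x}\times\pi^{(N)}_{\rm dist}\to\mathbb{R}$ if for all $(t,x)\in[0,T]\times\mathbb{R}^{n_x}$, all $i\in I_N$, all $\phi_i,\phi_i'\in\pi_i^{\rm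 dist}$ and all $\phi_{-i}=(\phi_j)_{j\ne i}\in\prod_{j\ne i}\pi_j^{\rm dist}$, $$\Phi^{t,x}((\phi_i',\phi_{-i}))-\Phi^{t,x}((\phi_i,\phi_{-i}))=V_i^{t,x}((\phi_i',\phi_{-i}))-V_i^{t,x}((\phi_i,\phi_{-i})),$$ where $\Phi^{t,x}(\phi)=\Phi(t,x,\phi)$.
   Formalization: The formal theorem additionally assumes that the time integral and expectation defining Φ exist for all t, x and φ; otherwise Φ need not be real-valued, e.g. f_i=0, g_i=G=0, F=1/t for t>0, U_{f_i}=-F gives Φ infinite at t=0. *)

theory Defs
  imports "HOL-Probability.Probability"
begin

section \<open>Euclidean spaces of varying dimension\<close>

text \<open>The dimensions depend on the player, so \<open>\<real>\<^sup>n\<close> is the set of functions on \<open>{..<n}\<close>,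
  extended by \<open>undefined\<close>, with the product (that is, Borel) sigma-algebra.\<close>

type_synonym vec = "nat \<Rightarrow> real"
type_synonym mat = "nat \<Rightarrow> nat \<Rightarrow> real"

definition euc :: "nat \<Rightarrow> vec measure" where
  "euc n = PiM {..<n} (\<lambda>_. borel)"

abbreviation euc_set :: "nat \<Rightarrow> vec set" where
  "euc_set n \<equiv> space (euc n)"

definition euc_mat :: "nat \<Rightarrow> nat \<Rightarrow> mat measure" where
  "euc_mat n d = PiM {..<n} (\<lambda>_. euc d)"

definition enorm :: "nat \<Rightarrow> vec \<Rightarrow> real" where
  "enorm n x = L2_set x {..<n}"

definition time :: "real \<Rightarrow> real measure" where
  "time T = restrict_space borel {0..T}"


section \<open>Brownian motion and the Ito integral\<close>

text \<open>A \<open>d\<close>-dimensional standard Brownian motion on \<open>[0,T]\<close> relative to a filtration.\<close>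

definition brownian_motion ::
  "'w measure \<Rightarrow> (real \<Rightarrow> 'w measure) \<Rightarrow> real \<Rightarrow> nat \<Rightarrow> (real \<Rightarrow> 'w \<Rightarrow> vec) \<Rightarrow> bool" where
  "brownian_motion M F T d W \<longleftrightarrow>
     prob_space M \<and> filtration (space M) F \<and> (\<forall>s. subalgebra M (F s)) \<and>
     (\<forall>s\<in>{0..T}. W s \<in> F s \<rightarrow>\<^sub>M euc d) \<and>
     (\<forall>\<omega>\<in>space M. \<forall>l<d. continuous_on {0..T} (\<lambda>s. W s \<omega> l)) \<and>
     (AE \<omega> in M. \<forall>l<d. W 0 \<omega> l = 0) \<and>
     (\<forall>r s. 0 \<le> r \<and> r < s \<and> s \<le> T \<longrightarrow>
        (let incr = (\<lambda>\<omega>. \<lambda>l\<in>{..<d}. W s \<omega> l - W r \<omega> l) in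
           prob_space.indep_set M (sets (F r)) {incr -` A \<inter> space M | A. A \<in> sets (euc d)} \<and>
           distr M (euc d) incr =
             PiM {..<d} (\<lambda>_. density lborel (\<lambda>y. ennreal (normal_density 0 (sqrt (s - r)) y)))))"

definition progressive ::
  "(real \<Rightarrow> 'w measure) \<Rightarrow> real \<Rightarrow> real \<Rightarrow> (real \<Rightarrow> 'w \<Rightarrow> real) \<Rightarrow> bool" where
  "progressive F a c H \<longleftrightarrow>
     (\<forall>u\<in>{a..c}. (\<lambda>(r, \<omega>). H r \<omega>) \<in> borel_measurable (restrict_space borel {a..u} \<Otimes>\<^sub>M F u))"

text \<open>A simple integrand on \<open>[a,c]\<close> is \<open>\<Sum>k<m. \<xi> k * indicator {r k<..r (k+1)}\<close> with bounded
  \<open>\<xi> k\<close> measurable at time \<open>r k\<close>.\<close>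

definition simple_integrand ::
  "'w measure \<Rightarrow> (real \<Rightarrow> 'w measure) \<Rightarrow> real \<Rightarrow> real \<Rightarrow>
   nat \<Rightarrow> (nat \<Rightarrow> real) \<Rightarrow> (nat \<Rightarrow> 'w \<Rightarrow> real) \<Rightarrow> bool" where
  "simple_integrand M F a c m r \<xi> \<longleftrightarrow>
     (\<forall>k<m. a \<le> r k \<and> r k \<le> r (Suc k) \<and> r (Suc k) \<le> c \<and>
            \<xi> k \<in> borel_measurable (F (r k)) \<and> bounded (\<xi> k ` space M))"

definition simple_val :: "nat \<Rightarrow> (nat \<Rightarrow> real) \<Rightarrow> (nat \<Rightarrow> 'w \<Rightarrow> real) \<Rightarrow> real \<Rightarrow> 'w \<Rightarrow> real" where
  "simple_val m r \<xi> u \<omega> = (\<Sum>k<m. \<xi> k \<omega> * indicator {r k<..r (Suc k)} u)"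

definition simple_int ::
  "nat \<Rightarrow> (nat \<Rightarrow> real) \<Rightarrow> (nat \<Rightarrow> 'w \<Rightarrow> real) \<Rightarrow> (real \<Rightarrow> 'w \<Rightarrow> real) \<Rightarrow> 'w \<Rightarrow> real" where
  "simple_int m r \<xi> B \<omega> = (\<Sum>k<m. \<xi> k \<omega> * (B (r (Suc k)) \<omega> - B (r k) \<omega>))"

text \<open>\<open>Y\<close> is (a version of) the Ito integral of \<open>H\<close> over \<open>[a,c]\<close> with respect to the scalar
  Brownian motion \<open>B\<close>: the limit in probability of the integrals of simple integrands whose
  squared \<open>L\<^sup>2(a,c)\<close> distance to \<open>H\<close> tends to zero in probability.\<close>

definition ito_integral ::
  "'w measure \<Rightarrow> (real \<Rightarrow> 'w measure) \<Rightarrow> real \<Rightarrow> real \<Rightarrow>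
   (real \<Rightarrow> 'w \<Rightarrow> real) \<Rightarrow> (real \<Rightarrow> 'w \<Rightarrow> real) \<Rightarrow> ('w \<Rightarrow> real) \<Rightarrow> bool" where
  "ito_integral M F a c H B Y \<longleftrightarrow>
     progressive F a c H \<and> Y \<in> borel_measurable M \<and>
     (\<exists>m r \<xi>. (\<forall>j::nat. simple_integrand M F a c (m j) (r j) (\<xi> j)) \<and>
        (\<forall>e>0. (\<lambda>j. measure M {\<omega>\<in>space M. ennreal e <
             (\<integral>\<^sup>+u\<in>{a..c}. ennreal ((H u \<omega> - simple_val (m j) (r j) (\<xi> j) u \<omega>)\<^sup>2) \<partial>lborel)})
           \<longlonglongrightarrow> 0) \<and>
        (\<forall>e>0. (\<lambda>j. measure M {\<omega>\<in>space M. e < \<bar>simple_int (m j) (r j) (\<xi> j) B \<omega> - Y \<omega>\<bar>})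
           \<longlonglongrightarrow> 0))"


section \<open>Weak solutions of stochastic differential equations\<close>

text \<open>\<open>X\<close> is a weak solution on \<open>(M, W)\<close> of
  \<open>dX = \<beta>(s,X) ds + \<Sigma>(s,X) dW\<close> on \<open>[t,T]\<close>, \<open>X_t = x\<close>. As usual for weak solutions the
  filtration is part of the solution and may be larger than the one generated by \<open>W\<close>.\<close>

definition weak_solution ::
  "'w measure \<Rightarrow> real \<Rightarrow> nat \<Rightarrow> (real \<Rightarrow> 'w \<Rightarrow> vec) \<Rightarrow> nat \<Rightarrow>
   (real \<times> vec \<Rightarrow> vec) \<Rightarrow> (real \<times> vec \<Rightarrow> mat) \<Rightarrow> real \<Rightarrow> vec \<Rightarrow> (real \<Rightarrow> 'w \<Rightarrow> vec) \<Rightarrow> bool" where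
  "weak_solution M T d W n \<beta> \<Sigma> t x X \<longleftrightarrow>
     (\<exists>F. brownian_motion M F T d W \<and>
        (\<forall>s\<in>{t..T}. X s \<in> F s \<rightarrow>\<^sub>M euc n) \<and>
        (\<forall>\<omega>\<in>space M. \<forall>l<n. continuous_on {t..T} (\<lambda>s. X s \<omega> l)) \<and>
        (AE \<omega> in M. X t \<omega> = x) \<and>
        (\<forall>l<n. AE \<omega> in M. set_integrable lborel {t..T} (\<lambda>u. \<beta> (u, X u \<omega>) l)) \<and>
        (\<forall>l<n. \<forall>q<d. AE \<omega> in M.
           set_integrable lborel {t..T} (\<lambda>u. (\<Sigma> (u, X u \<omega>) l q)\<^sup>2)) \<and>
        (\<exists>J. (\<forall>s\<in>{t..T}. \<forall>l<n. \<forall>q<d.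
                ito_integral M F t s (\<lambda>u \<omega>. \<Sigma> (u, X u \<omega>) l q) (\<lambda>u \<omega>. W u \<omega> q) (J s l q)) \<and>
             (\<forall>s\<in>{t..T}. \<forall>l<n. AE \<omega> in M.
                X s \<omega> l = x l + (LINT u:{t..s}|lborel. \<beta> (u, X u \<omega>) l) + (\<Sum>q<d. J s l q \<omega>))))"

definition sq_weak_solution ::
  "'w measure \<Rightarrow> real \<Rightarrow> nat \<Rightarrow> (real \<Rightarrow> 'w \<Rightarrow> vec) \<Rightarrow> nat \<Rightarrow>
   (real \<times> vec \<Rightarrow> vec) \<Rightarrow> (real \<times> vec \<Rightarrow> mat) \<Rightarrow> real \<Rightarrow> vec \<Rightarrow> (real \<Rightarrow> 'w \<Rightarrow> vec) \<Rightarrow> bool" where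
  "sq_weak_solution M T d W n \<beta> \<Sigma> t x X \<longleftrightarrow>
     weak_solution M T d W n \<beta> \<Sigma> t x X \<and>
     (\<integral>\<^sup>+\<omega>. (SUP s\<in>{t..T}. ennreal ((enorm n (X s \<omega>))\<^sup>2)) \<partial>M) < \<infinity>"

definition path_law ::
  "'w measure \<Rightarrow> real \<Rightarrow> real \<Rightarrow> nat \<Rightarrow> (real \<Rightarrow> 'w \<Rightarrow> vec) \<Rightarrow> (real \<Rightarrow> vec) measure" where
  "path_law M t T n X = distr M (PiM {t..T} (\<lambda>_. euc n)) (\<lambda>\<omega>. \<lambda>s\<in>{t..T}. X s \<omega>)"

text \<open>Uniqueness is uniqueness in law. The competing solutions may live on any probability space;
  letting the sample space be a set of pairs (state path, noise path) loses no generality, since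
  every solution can be transferred to that space along \<open>\<omega> \<mapsto> (X \<omega>, W \<omega>)\<close>.\<close>

definition unique_sq_weak_solution ::
  "'w measure \<Rightarrow> real \<Rightarrow> nat \<Rightarrow> (real \<Rightarrow> 'w \<Rightarrow> vec) \<Rightarrow> nat \<Rightarrow>
   (real \<times> vec \<Rightarrow> vec) \<Rightarrow> (real \<times> vec \<Rightarrow> mat) \<Rightarrow> real \<Rightarrow> vec \<Rightarrow> bool" where
  "unique_sq_weak_solution M T d W n \<beta> \<Sigma> t x \<longleftrightarrow>
     (\<exists>X. sq_weak_solution M T d W n \<beta> \<Sigma> t x X \<and>
        (\<forall>(M' :: ((real \<Rightarrow> vec) \<times> (real \<Rightarrow> vec)) measure) W' X'.
           sq_weak_solution M' T d W' n \<beta> \<Sigma> t x X' \<longrightarrow>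
           path_law M' t T n X' = path_law M t T n X))"


section \<open>The distributed game\<close>

type_synonym policy = "real \<times> vec \<Rightarrow> vec"
type_synonym profile = "nat \<Rightarrow> policy"
type_synonym joint = "nat \<Rightarrow> vec"

text \<open>\<open>sol G i t x \<phi>\<close> is the process \<open>X\<^bsup>t,x,\<phi>\<^esup>\<close> of player \<open>i\<close>; it is determined by the rest of the
  data only up to its law, hence it belongs to the data of the game. All these processes live on
  the one probability space \<open>prb G\<close> and are driven by the one Brownian motion \<open>noise G\<close>.\<close>

record 'w dist_game =
  horizon :: real
  num :: nat
  sdim :: "nat \<Rightarrow> nat"
  adim :: "nat \<Rightarrow> nat"
  wdim :: nat
  acts :: "nat \<Rightarrow> vec set"
  drift :: "nat \<Rightarrow> real \<times> vec \<times> vec \<Rightarrow> vec"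
  vol :: "nat \<Rightarrow> real \<times> vec \<times> vec \<Rightarrow> mat"
  running :: "nat \<Rightarrow> real \<times> joint \<times> joint \<Rightarrow> real"
  terminal :: "nat \<Rightarrow> joint \<Rightarrow> real"
  prb :: "'w measure"
  noise :: "real \<Rightarrow> 'w \<Rightarrow> vec"
  sol :: "nat \<Rightarrow> real \<Rightarrow> vec \<Rightarrow> policy \<Rightarrow> real \<Rightarrow> 'w \<Rightarrow> vec"

definition players :: "'w dist_game \<Rightarrow> nat set" where
  "players G = {1..num G}"

text \<open>\<open>\<Prod>j\<in>J. \<real>\<^bsup>n_j\<^esup>\<close> and \<open>\<Prod>j\<in>J. \<real>\<^bsup>k_j\<^esup>\<close>; for \<open>J = players G\<close> these are the spaces
  \<open>\<real>\<^bsup>n_x\<^esup>\<close> and \<open>\<real>\<^bsup>n_a\<^esup>\<close>.\<close>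

definition states :: "'w dist_game \<Rightarrow> nat set \<Rightarrow> joint measure" where
  "states G J = PiM J (\<lambda>j. euc (sdim G j))"

definition actions :: "'w dist_game \<Rightarrow> nat set \<Rightarrow> joint measure" where
  "actions G J = PiM J (\<lambda>j. euc (adim G j))"

definition state_norm :: "'w dist_game \<Rightarrow> joint \<Rightarrow> real" where
  "state_norm G x = L2_set (\<lambda>j. enorm (sdim G j) (x j)) (players G)"

definition action_norm :: "'w dist_game \<Rightarrow> joint \<Rightarrow> real" where
  "action_norm G a = L2_set (\<lambda>j. enorm (adim G j) (a j)) (players G)"

definition others :: "'w dist_game \<Rightarrow> nat \<Rightarrow> nat set" where
  "others G i = players G - {i}"

definition closed_drift :: "'w dist_game \<Rightarrow> nat \<Rightarrow> policy \<Rightarrow> real \<times> vec \<Rightarrow> vec" where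
  "closed_drift G i \<phi> = (\<lambda>(s, y). drift G i (s, y, \<phi> (s, y)))"

definition closed_vol :: "'w dist_game \<Rightarrow> nat \<Rightarrow> policy \<Rightarrow> real \<times> vec \<Rightarrow> mat" where
  "closed_vol G i \<phi> = (\<lambda>(s, y). vol G i (s, y, \<phi> (s, y)))"

definition policies :: "'w dist_game \<Rightarrow> nat \<Rightarrow> policy set" where
  "policies G i =
     {\<phi> \<in> ({0..horizon G} \<times> euc_set (sdim G i)) \<rightarrow>\<^sub>E acts G i.
        \<phi> \<in> time (horizon G) \<Otimes>\<^sub>M euc (sdim G i) \<rightarrow>\<^sub>M euc (adim G i) \<and>
        bdd_above ((\<lambda>(t, y). enorm (adim G i) (\<phi> (t, y)) / (1 + enorm (sdim G i) y))
                     ` ({0..horizon G} \<times> euc_set (sdim G i))) \<and>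
        (\<forall>t\<in>{0..horizon G}. \<forall>y\<in>euc_set (sdim G i).
           unique_sq_weak_solution (prb G) (horizon G) (wdim G) (noise G) (sdim G i)
             (closed_drift G i \<phi>) (closed_vol G i \<phi>) t y)}"

definition profiles :: "'w dist_game \<Rightarrow> nat set \<Rightarrow> profile set" where
  "profiles G J = PiE J (policies G)"

definition distributed_game :: "'w dist_game \<Rightarrow> bool" where
  "distributed_game G \<longleftrightarrow>
     0 < horizon G \<and>
     (\<exists>F. brownian_motion (prb G) F (horizon G) (wdim G) (noise G)) \<and>
     (\<forall>i\<in>players G.
        acts G i \<in> sets (euc (adim G i)) \<and>
        drift G i \<in> time (horizon G) \<Otimes>\<^sub>M euc (sdim G i) \<Otimes>\<^sub>M euc (adim G i) \<rightarrow>\<^sub>M euc (sdim G i) \<and>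
        vol G i \<in> time (horizon G) \<Otimes>\<^sub>M euc (sdim G i) \<Otimes>\<^sub>M euc (adim G i)
                     \<rightarrow>\<^sub>M euc_mat (sdim G i) (wdim G) \<and>
        running G i \<in> borel_measurable
          (time (horizon G) \<Otimes>\<^sub>M states G (players G) \<Otimes>\<^sub>M actions G (players G)) \<and>
        bdd_above ((\<lambda>(t, x, a). \<bar>running G i (t, x, a)\<bar> /
                                 (1 + (state_norm G x)\<^sup>2 + (action_norm G a)\<^sup>2))
          ` ({0..horizon G} \<times> space (states G (players G)) \<times> space (actions G (players G)))) \<and>
        terminal G i \<in> borel_measurable (states G (players G)) \<and>
        bdd_above ((\<lambda>x. \<bar>terminal G i x\<bar> / (1 + (state_norm G x)\<^sup>2))
          ` space (states G (players G))) \<and>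
        (\<forall>t\<in>{0..horizon G}. \<forall>y\<in>euc_set (sdim G i). \<forall>\<phi>\<in>policies G i.
           sq_weak_solution (prb G) (horizon G) (wdim G) (noise G) (sdim G i)
             (closed_drift G i \<phi>) (closed_vol G i \<phi>) t y (sol G i t y \<phi>)))"

definition joint_state ::
  "'w dist_game \<Rightarrow> real \<Rightarrow> joint \<Rightarrow> profile \<Rightarrow> real \<Rightarrow> 'w \<Rightarrow> joint" where
  "joint_state G t x \<phi> s \<omega> = (\<lambda>i\<in>players G. sol G i t (x i) (\<phi> i) s \<omega>)"

definition joint_control ::
  "'w dist_game \<Rightarrow> real \<Rightarrow> joint \<Rightarrow> profile \<Rightarrow> real \<Rightarrow> 'w \<Rightarrow> joint" where
  "joint_control G t x \<phi> s \<omega> = (\<lambda>i\<in>players G. \<phi> i (s, sol G i t (x i) (\<phi> i) s \<omega>))"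

definition payoff ::
  "'w dist_game \<Rightarrow> (real \<times> joint \<times> joint \<Rightarrow> real) \<Rightarrow> (joint \<Rightarrow> real) \<Rightarrow>
   real \<Rightarrow> joint \<Rightarrow> profile \<Rightarrow> real" where
  "payoff G f g t x \<phi> =
     (LINT \<omega>|prb G.
        (LINT s:{t..horizon G}|lborel. f (s, joint_state G t x \<phi> s \<omega>, joint_control G t x \<phi> s \<omega>))
        + g (joint_state G t x \<phi> (horizon G) \<omega>))"

text \<open>Both integrals in \<open>payoff\<close> exist; the library assigns the value 0 to integrals that do not
  exist. For the potential this is not automatic: nothing controls the dependence of \<open>F\<close> on
  time alone, as in \<open>F(t,x,a) = 1/t\<close> compensated by \<open>U\<close>.\<close>

definition payoff_exists ::
  "'w dist_game \<Rightarrow> (real \<times> joint \<times> joint \<Rightarrow> real) \<Rightarrow> (joint \<Rightarrow> real) \<Rightarrow>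
   real \<Rightarrow> joint \<Rightarrow> profile \<Rightarrow> bool" where
  "payoff_exists G f g t x \<phi> \<longleftrightarrow>
     (AE \<omega> in prb G. set_integrable lborel {t..horizon G}
        (\<lambda>s. f (s, joint_state G t x \<phi> s \<omega>, joint_control G t x \<phi> s \<omega>))) \<and>
     integrable (prb G) (\<lambda>\<omega>.
        (LINT s:{t..horizon G}|lborel. f (s, joint_state G t x \<phi> s \<omega>, joint_control G t x \<phi> s \<omega>))
        + g (joint_state G t x \<phi> (horizon G) \<omega>))"

definition value_fun :: "'w dist_game \<Rightarrow> nat \<Rightarrow> real \<Rightarrow> joint \<Rightarrow> profile \<Rightarrow> real" where
  "value_fun G i = payoff G (running G i) (terminal G i)"

definition markov_potential_game ::
  "'w dist_game \<Rightarrow> (real \<Rightarrow> joint \<Rightarrow> profile \<Rightarrow> real) \<Rightarrow> bool" where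
  "markov_potential_game G \<Phi> \<longleftrightarrow>
     (\<forall>t\<in>{0..horizon G}. \<forall>x\<in>space (states G (players G)). \<forall>i\<in>players G.
        \<forall>\<phi>\<in>policies G i. \<forall>\<phi>'\<in>policies G i. \<forall>\<psi>\<in>profiles G (others G i).
          \<Phi> t x (\<psi>(i := \<phi>')) - \<Phi> t x (\<psi>(i := \<phi>)) =
          value_fun G i t x (\<psi>(i := \<phi>')) - value_fun G i t x (\<psi>(i := \<phi>)))"

end

theory Submission
  imports Defs
begin

text \<open>In a distributed game player \<open>j\<close>'s state and control are driven by \<open>j\<close>'s own policy alone.
  Hence, when player \<open>i\<close> deviates, the difference between \<open>i\<close>'s cost and the potential, which is
  \<open>Uf i\<close> and \<open>Ug i\<close> evaluated along the trajectories of the others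
  (\<open>restrict_others_deviation\<close>), is pathwise unchanged, and so is its expectation.

  Passing from the pathwise identity to expectations requires every integral involved to exist.
  For the potential this is assumed, and the contribution of \<open>Uf i\<close> and \<open>Ug i\<close> is then integrable
  as the difference of two integrable random variables (\<open>payoff_diff_cong\<close>). For the
  value functions existence is a consequence of the growth conditions
  (\<open>payoff_exists_of_quadratic_growth\<close>): continuity of paths makes a solution jointly measurable in
  time and chance, square-integrability and Tonelli make its squared norm integrable on
  \<open>[t,T] \<times> \<Omega>\<close>, linear growth of the policies transfers this to the controls, and quadratic growth of
  the costs dominates them by these squared norms. Fubini then yields both the pathwise time integral
  and its expectation.\<close>

section \<open>Square-integrable weak solutions as processes on the product space\<close>

text \<open>The process is the pointwise limit of its values at the times rounded down to the grid of mesh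
  \<open>1 / (n + 1)\<close>; such an approximation runs through countably many random variables only.\<close>

lemma joint_measurable_of_continuous_paths:
  fixes X :: "real \<Rightarrow> 'w \<Rightarrow> real"
  assumes ab: "a \<le> b"
    and meas: "\<And>s. s \<in> {a..b} \<Longrightarrow> X s \<in> borel_measurable M"
    and cont: "\<And>\<omega>. \<omega> \<in> space M \<Longrightarrow> continuous_on {a..b} (\<lambda>s. X s \<omega>)"
  shows "(\<lambda>p. X (fst p) (snd p)) \<in> borel_measurable (restrict_space lborel {a..b} \<Otimes>\<^sub>M M)"
proof -
  \<comment> \<open>Rounding down may leave the interval at its left end, where nothing is known about \<open>X\<close>.\<close>
  define clamp where "clamp r = max a (min b r)" for r :: real
  define grid where "grid n s = clamp (real_of_int \<lfloor>real (Suc n) * s\<rfloor> / real (Suc n))" for n s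
  have clamp: "clamp r \<in> {a..b}" for r
    using ab by (auto simp: clamp_def)
  have grid_lim: "(\<lambda>n. grid n s) \<longlonglongrightarrow> s" if s: "s \<in> {a..b}" for s
  proof -
    have "(\<lambda>n. real_of_int \<lfloor>real (Suc n) * s\<rfloor> / real (Suc n)) \<longlonglongrightarrow> s"
    proof (rule tendsto_sandwich)
      show "\<forall>\<^sub>F n in sequentially.
          s - 1 / real (Suc n) \<le> real_of_int \<lfloor>real (Suc n) * s\<rfloor> / real (Suc n)"
      proof (intro always_eventually allI)
        fix n
        have "real (Suc n) * s - 1 \<le> real_of_int \<lfloor>real (Suc n) * s\<rfloor>" by linarith
        then have "(real (Suc n) * s - 1) / real (Suc n)
            \<le> real_of_int \<lfloor>real (Suc n) * s\<rfloor> / real (Suc n)"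
          by (rule divide_right_mono) simp
        then show "s - 1 / real (Suc n) \<le> real_of_int \<lfloor>real (Suc n) * s\<rfloor> / real (Suc n)"
          by (simp add: diff_divide_distrib)
      qed
      show "\<forall>\<^sub>F n in sequentially. real_of_int \<lfloor>real (Suc n) * s\<rfloor> / real (Suc n) \<le> s"
        by (intro always_eventually allI)
           (simp add: pos_divide_le_eq mult.commute del: of_nat_Suc)
      show "(\<lambda>n. s - 1 / real (Suc n)) \<longlonglongrightarrow> s"
        using tendsto_diff[OF tendsto_const LIMSEQ_inverse_real_of_nat, of s]
        by (simp add: inverse_eq_divide)
    qed simp
    then have "(\<lambda>n. grid n s) \<longlonglongrightarrow> clamp s"
      unfolding grid_def clamp_def by (intro tendsto_intros)
    then show ?thesis using s by (simp add: clamp_def)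
  qed
  show ?thesis
  proof (rule borel_measurable_LIMSEQ_real)
    fix n
    have 1: "(\<lambda>p. \<lfloor>real (Suc n) * fst p\<rfloor>)
        \<in> restrict_space lborel {a..b} \<Otimes>\<^sub>M M \<rightarrow>\<^sub>M count_space UNIV"
    proof -
      have "(\<lambda>s::real. \<lfloor>real (Suc n) * s\<rfloor>) \<in> restrict_space lborel {a..b} \<rightarrow>\<^sub>M count_space UNIV"
        by (rule measurable_restrict_space1) simp
      from measurable_compose[OF measurable_fst this] show ?thesis .
    qed
    have 2: "(\<lambda>p. X (clamp (real_of_int k / real (Suc n))) (snd p))
        \<in> borel_measurable (restrict_space lborel {a..b} \<Otimes>\<^sub>M M)" for k
      using measurable_compose[OF measurable_snd meas[OF clamp]] .
    show "(\<lambda>p. X (grid n (fst p)) (snd p)) \<in> borel_measurable (restrict_space lborel {a..b} \<Otimes>\<^sub>M M)"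
      unfolding grid_def
      by (rule measurable_compose_countable
          [where f="\<lambda>k p. X (clamp (real_of_int k / real (Suc n))) (snd p)", OF 2 1])
  next
    fix p assume "p \<in> space (restrict_space lborel {a..b} \<Otimes>\<^sub>M M)"
    then have s: "fst p \<in> {a..b}" and w: "snd p \<in> space M"
      by (auto simp: space_pair_measure space_restrict_space)
    have "\<forall>\<^sub>F n in sequentially. grid n (fst p) \<in> {a..b}"
      using clamp by (simp add: grid_def del: atLeastAtMost_iff)
    then show "(\<lambda>n. X (grid n (fst p)) (snd p)) \<longlonglongrightarrow> X (fst p) (snd p)"
      using continuous_on_tendsto_compose[OF cont[OF w] grid_lim[OF s] s] by simp
  qed
qed

lemma enorm_nonneg: "0 \<le> enorm n x"
  by (simp add: enorm_def)

lemma measurable_enorm: "enorm n \<in> borel_measurable (euc n)"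
  unfolding enorm_def L2_set_def euc_def by measurable

context
  fixes M :: "'w measure" and T d W n \<beta> \<Sigma> t x X
  assumes sol: "sq_weak_solution M T d W n \<beta> \<Sigma> t x X"
begin

lemma sq_weak_solution_prob_space: "prob_space M"
  using sol by (auto simp: sq_weak_solution_def weak_solution_def brownian_motion_def)

lemma sq_weak_solution_marginal_measurable:
  assumes "s \<in> {t..T}" shows "X s \<in> M \<rightarrow>\<^sub>M euc n"
proof -
  from sol obtain F where "brownian_motion M F T d W" "X s \<in> F s \<rightarrow>\<^sub>M euc n"
    using assms unfolding sq_weak_solution_def weak_solution_def by blast
  then show ?thesis
    by (auto simp: brownian_motion_def intro: measurable_from_subalg)
qed

lemma sq_weak_solution_measurable:
  assumes "t \<le> T"
  shows "(\<lambda>p. X (fst p) (snd p)) \<in> restrict_space lborel {t..T} \<Otimes>\<^sub>M M \<rightarrow>\<^sub>M euc n"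
  unfolding euc_def
proof (rule measurable_PiM_single')
  fix l assume l: "l \<in> {..<n}"
  show "(\<lambda>p. X (fst p) (snd p) l) \<in> borel_measurable (restrict_space lborel {t..T} \<Otimes>\<^sub>M M)"
  proof (rule joint_measurable_of_continuous_paths[where X="\<lambda>s \<omega>. X s \<omega> l", OF assms])
    fix s assume "s \<in> {t..T}"
    from sq_weak_solution_marginal_measurable[OF this] show "(\<lambda>\<omega>. X s \<omega> l) \<in> borel_measurable M"
      unfolding euc_def using l by (rule measurable_compose[OF _ measurable_component_singleton])
  next
    fix \<omega> assume "\<omega> \<in> space M"
    then show "continuous_on {t..T} (\<lambda>s. X s \<omega> l)"
      using sol l unfolding sq_weak_solution_def weak_solution_def by blast
  qed
next
  show "(\<lambda>p. X (fst p) (snd p)) \<in> space (restrict_space lborel {t..T} \<Otimes>\<^sub>M M)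
      \<rightarrow> (\<Pi>\<^sub>E l\<in>{..<n}. space borel)"
  proof
    fix p assume "p \<in> space (restrict_space lborel {t..T} \<Otimes>\<^sub>M M)"
    then have "fst p \<in> {t..T}" "snd p \<in> space M"
      by (auto simp: space_pair_measure space_restrict_space)
    from measurable_space[OF sq_weak_solution_marginal_measurable[OF this(1)] this(2)]
    show "X (fst p) (snd p) \<in> (\<Pi>\<^sub>E l\<in>{..<n}. space borel)"
      by (simp add: euc_def space_PiM)
  qed
qed

text \<open>The right-hand side bounds the second moment uniformly in \<open>s\<close>, which is what Tonelli needs later.
  The nonnegative integral is monotone for arbitrary functions, so the supremum over uncountably many
  times is harmless here.\<close>

lemma sq_weak_solution_marginal_second_moment:
  assumes "s \<in> {t..T}"
  shows "(\<integral>\<^sup>+\<omega>. ennreal ((enorm n (X s \<omega>))\<^sup>2) \<partial>M)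
    \<le> (\<integral>\<^sup>+\<omega>. (SUP u\<in>{t..T}. ennreal ((enorm n (X u \<omega>))\<^sup>2)) \<partial>M)"
  using assms by (intro nn_integral_mono SUP_upper)

lemma sq_weak_solution_marginal_integrable:
  assumes "s \<in> {t..T}"
  shows "integrable M (\<lambda>\<omega>. (enorm n (X s \<omega>))\<^sup>2)"
proof (rule integrableI_nonneg)
  show "(\<lambda>\<omega>. (enorm n (X s \<omega>))\<^sup>2) \<in> borel_measurable M"
    using measurable_compose[OF sq_weak_solution_marginal_measurable[OF assms] measurable_enorm]
    by measurable
  show "(\<integral>\<^sup>+\<omega>. ennreal ((enorm n (X s \<omega>))\<^sup>2) \<partial>M) < \<infinity>"
    using sq_weak_solution_marginal_second_moment[OF assms] sol
    by (auto simp: sq_weak_solution_def intro: le_less_trans)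
qed simp

lemma sq_weak_solution_integrable:
  assumes tT: "t \<le> T"
  shows "integrable (restrict_space lborel {t..T} \<Otimes>\<^sub>M M)
    (\<lambda>p. (enorm n (X (fst p) (snd p)))\<^sup>2)"
proof (rule integrableI_nonneg)
  interpret prob_space M by (rule sq_weak_solution_prob_space)
  let ?L = "restrict_space lborel {t..T}"
  let ?S = "\<integral>\<^sup>+\<omega>. (SUP u\<in>{t..T}. ennreal ((enorm n (X u \<omega>))\<^sup>2)) \<partial>M"
  show m: "(\<lambda>p. (enorm n (X (fst p) (snd p)))\<^sup>2) \<in> borel_measurable (?L \<Otimes>\<^sub>M M)"
    using measurable_compose[OF sq_weak_solution_measurable[OF tT] measurable_enorm] by measurable
  have "(\<integral>\<^sup>+p. ennreal ((enorm n (X (fst p) (snd p)))\<^sup>2) \<partial>(?L \<Otimes>\<^sub>M M))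
      = (\<integral>\<^sup>+s. \<integral>\<^sup>+\<omega>. ennreal ((enorm n (X s \<omega>))\<^sup>2) \<partial>M \<partial>?L)"
    using nn_integral_fst[of "\<lambda>p. ennreal ((enorm n (X (fst p) (snd p)))\<^sup>2)" ?L] m by simp
  also have "\<dots> \<le> (\<integral>\<^sup>+s. ?S \<partial>?L)"
    by (intro nn_integral_mono sq_weak_solution_marginal_second_moment)
       (simp add: space_restrict_space)
  also have "\<dots> = ?S * emeasure lborel {t..T}"
    by (simp add: emeasure_restrict_space space_restrict_space)
  also have "\<dots> < \<infinity>"
    using sol by (simp add: sq_weak_solution_def ennreal_mult_less_top emeasure_lborel_Icc_eq)
  finally show "(\<integral>\<^sup>+p. ennreal ((enorm n (X (fst p) (snd p)))\<^sup>2) \<partial>(?L \<Otimes>\<^sub>M M)) < \<infinity>" .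
qed simp

end

section \<open>Growth of policies and of the cost functionals\<close>

text \<open>The squared form of the linear growth condition, by \<open>(1 + r)\<^sup>2 \<le> 2 (1 + r\<^sup>2)\<close>.\<close>

lemma policy_quadratic_growth:
  assumes "\<phi> \<in> policies G i"
  obtains K where "0 \<le> K"
    "\<And>s y. s \<in> {0..horizon G} \<Longrightarrow> y \<in> euc_set (sdim G i) \<Longrightarrow>
      (enorm (adim G i) (\<phi> (s, y)))\<^sup>2 \<le> K * (1 + (enorm (sdim G i) y)\<^sup>2)"
proof -
  from assms obtain B where B: "\<And>s y. s \<in> {0..horizon G} \<Longrightarrow> y \<in> euc_set (sdim G i) \<Longrightarrow>
      enorm (adim G i) (\<phi> (s, y)) / (1 + enorm (sdim G i) y) \<le> B"
    unfolding policies_def bdd_above_def by fast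
  have "(enorm (adim G i) (\<phi> (s, y)))\<^sup>2 \<le> 2 * B\<^sup>2 * (1 + (enorm (sdim G i) y)\<^sup>2)"
    if "s \<in> {0..horizon G}" "y \<in> euc_set (sdim G i)" for s y
  proof -
    let ?y = "enorm (sdim G i) y"
    have y: "0 \<le> ?y" by (rule enorm_nonneg)
    have "enorm (adim G i) (\<phi> (s, y)) \<le> B * (1 + ?y)"
      using B[OF that] y by (simp add: pos_divide_le_eq)
    then have "(enorm (adim G i) (\<phi> (s, y)))\<^sup>2 \<le> (B * (1 + ?y))\<^sup>2"
      by (intro power_mono enorm_nonneg)
    also have "\<dots> = B\<^sup>2 * (1 + ?y)\<^sup>2" by (simp add: power_mult_distrib)
    also have "\<dots> \<le> B\<^sup>2 * (2 * (1 + ?y\<^sup>2))"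
      using zero_le_power2[of "1 - ?y"]
      by (intro mult_left_mono) (simp_all add: power2_eq_square algebra_simps)
    finally show ?thesis by (simp add: algebra_simps)
  qed
  then show thesis by (intro that[of "2 * B\<^sup>2"]) auto
qed

lemma state_norm_power2:
  "(state_norm G x)\<^sup>2 = (\<Sum>j\<in>players G. (enorm (sdim G j) (x j))\<^sup>2)"
  by (simp add: state_norm_def L2_set_def sum_nonneg)

lemma action_norm_power2:
  "(action_norm G a)\<^sup>2 = (\<Sum>j\<in>players G. (enorm (adim G j) (a j))\<^sup>2)"
  by (simp add: action_norm_def L2_set_def sum_nonneg)

context
  fixes G :: "'w dist_game" and t x \<phi>
  assumes game: "distributed_game G"
    and t: "t \<in> {0..horizon G}"
    and x: "x \<in> space (states G (players G))"
    and \<phi>: "\<phi> \<in> profiles G (players G)"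
begin

lemma profile_policy: "j \<in> players G \<Longrightarrow> \<phi> j \<in> policies G j"
  using \<phi> by (auto simp: profiles_def)

lemma sol_sq_weak_solution:
  assumes "j \<in> players G"
  shows "sq_weak_solution (prb G) (horizon G) (wdim G) (noise G) (sdim G j)
    (closed_drift G j (\<phi> j)) (closed_vol G j (\<phi> j)) t (x j) (sol G j t (x j) (\<phi> j))"
proof -
  have "x j \<in> euc_set (sdim G j)"
    using x assms by (auto simp: states_def space_PiM)
  then show ?thesis
    using game t assms profile_policy[OF assms] unfolding distributed_game_def by blast
qed

lemma prob_space_prb: "prob_space (prb G)"
  using game by (auto simp: distributed_game_def brownian_motion_def)

lemma sol_measurable:
  assumes "j \<in> players G"
  shows "(\<lambda>p. sol G j t (x j) (\<phi> j) (fst p) (snd p))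
    \<in> restrict_space lborel {t..horizon G} \<Otimes>\<^sub>M prb G \<rightarrow>\<^sub>M euc (sdim G j)"
  using sq_weak_solution_measurable[OF sol_sq_weak_solution[OF assms]] t by simp

lemma joint_state_measurable:
  "(\<lambda>p. joint_state G t x \<phi> (fst p) (snd p))
    \<in> restrict_space lborel {t..horizon G} \<Otimes>\<^sub>M prb G \<rightarrow>\<^sub>M states G (players G)"
  unfolding joint_state_def states_def by (intro measurable_restrict sol_measurable)

lemma fst_measurable_time:
  "fst \<in> restrict_space lborel {t..horizon G} \<Otimes>\<^sub>M M \<rightarrow>\<^sub>M time (horizon G)"
proof -
  have "(\<lambda>s::real. s) \<in> restrict_space lborel {t..horizon G} \<rightarrow>\<^sub>M time (horizon G)"
    unfolding time_def using t
    by (intro measurable_restrict_space2 measurable_restrict_space1)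
       (auto simp: space_restrict_space)
  from measurable_compose[OF measurable_fst this] show ?thesis .
qed

lemma joint_control_measurable:
  "(\<lambda>p. joint_control G t x \<phi> (fst p) (snd p))
    \<in> restrict_space lborel {t..horizon G} \<Otimes>\<^sub>M prb G \<rightarrow>\<^sub>M actions G (players G)"
  unfolding joint_control_def actions_def
proof (intro measurable_restrict)
  fix j assume j: "j \<in> players G"
  have "\<phi> j \<in> time (horizon G) \<Otimes>\<^sub>M euc (sdim G j) \<rightarrow>\<^sub>M euc (adim G j)"
    using profile_policy[OF j] by (auto simp: policies_def)
  then show "(\<lambda>p. \<phi> j (fst p, sol G j t (x j) (\<phi> j) (fst p) (snd p)))
      \<in> restrict_space lborel {t..horizon G} \<Otimes>\<^sub>M prb G \<rightarrow>\<^sub>M euc (adim G j)"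
    by (rule measurable_compose[OF measurable_Pair[OF fst_measurable_time sol_measurable[OF j]]])
qed

lemma joint_state_control_in_space:
  assumes "s \<in> {t..horizon G}" "\<omega> \<in> space (prb G)"
  shows "joint_state G t x \<phi> s \<omega> \<in> space (states G (players G))"
    and "joint_control G t x \<phi> s \<omega> \<in> space (actions G (players G))"
proof -
  have "(s, \<omega>) \<in> space (restrict_space lborel {t..horizon G} \<Otimes>\<^sub>M prb G)"
    using assms by (simp add: space_pair_measure space_restrict_space)
  from measurable_space[OF joint_state_measurable this]
    measurable_space[OF joint_control_measurable this]
  show "joint_state G t x \<phi> s \<omega> \<in> space (states G (players G))"
    and "joint_control G t x \<phi> s \<omega> \<in> space (actions G (players G))"
    by simp_all
qed

text \<open>Both norms in the growth bounds are sums over the players, so everything is dominated by an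
  affine function of the squared norms of the individual solutions. The domination takes place on
  the product \<open>[t,T] \<times> \<Omega>\<close>, where a single application of Fubini gives almost sure integrability in
  time together with measurability and integrability of the time integral in \<open>\<omega>\<close>.\<close>

lemma payoff_exists_of_quadratic_growth:
  assumes f: "f \<in> borel_measurable
      (time (horizon G) \<Otimes>\<^sub>M states G (players G) \<Otimes>\<^sub>M actions G (players G))"
    and f_growth: "bdd_above ((\<lambda>(t, x, a). \<bar>f (t, x, a)\<bar> /
        (1 + (state_norm G x)\<^sup>2 + (action_norm G a)\<^sup>2))
      ` ({0..horizon G} \<times> space (states G (players G)) \<times> space (actions G (players G))))"
    and g: "g \<in> borel_measurable (states G (players G))"
    and g_growth: "bdd_above ((\<lambda>x. \<bar>g x\<bar> / (1 + (state_norm G x)\<^sup>2))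
      ` space (states G (players G)))"
  shows "payoff_exists G f g t x \<phi>"
proof -
  let ?L = "restrict_space lborel {t..horizon G}" and ?M = "prb G" and ?P = "players G"
  let ?X = "joint_state G t x \<phi>" and ?A = "joint_control G t x \<phi>"
  interpret M: prob_space ?M by (rule prob_space_prb)
  interpret L: finite_measure ?L
    by (rule finite_measureI) (simp add: emeasure_restrict_space space_restrict_space emeasure_lborel_Icc_eq)
  interpret pair_sigma_finite ?L ?M ..
  interpret LM: finite_measure "?L \<Otimes>\<^sub>M ?M"
    by (rule finite_measure_pair_measure) unfold_locales
  have tT: "t \<le> horizon G" using t by simp
  have T: "horizon G \<in> {t..horizon G}" using t by simp
  obtain C where C: "\<And>s y a. s \<in> {0..horizon G} \<Longrightarrow> y \<in> space (states G ?P) \<Longrightarrow>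
      a \<in> space (actions G ?P) \<Longrightarrow>
      \<bar>f (s, y, a)\<bar> / (1 + (state_norm G y)\<^sup>2 + (action_norm G a)\<^sup>2) \<le> C"
    using f_growth unfolding bdd_above_def
    by (simp add: split_paired_Ball_Sigma del: atLeastAtMost_iff) blast
  obtain D where D: "\<And>y. y \<in> space (states G ?P) \<Longrightarrow> \<bar>g y\<bar> / (1 + (state_norm G y)\<^sup>2) \<le> D"
    using g_growth unfolding bdd_above_def by fast
  have "\<forall>j\<in>?P. \<exists>K\<ge>0. \<forall>s\<in>{0..horizon G}. \<forall>y\<in>euc_set (sdim G j).
      (enorm (adim G j) (\<phi> j (s, y)))\<^sup>2 \<le> K * (1 + (enorm (sdim G j) y)\<^sup>2)"
    by (meson policy_quadratic_growth profile_policy)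
  then obtain K where K0: "\<And>j. j \<in> ?P \<Longrightarrow> 0 \<le> K j"
    and K: "\<And>j s y. j \<in> ?P \<Longrightarrow> s \<in> {0..horizon G} \<Longrightarrow> y \<in> euc_set (sdim G j) \<Longrightarrow>
      (enorm (adim G j) (\<phi> j (s, y)))\<^sup>2 \<le> K j * (1 + (enorm (sdim G j) y)\<^sup>2)"
    by (auto dest!: bchoice simp del: atLeastAtMost_iff)
  define z where "z j s \<omega> = (enorm (sdim G j) (sol G j t (x j) (\<phi> j) s \<omega>))\<^sup>2" for j s \<omega>
  have state_z: "(state_norm G (?X s \<omega>))\<^sup>2 = (\<Sum>j\<in>?P. z j s \<omega>)" for s \<omega>
    unfolding state_norm_power2 joint_state_def z_def by (rule sum.cong) auto
  have z_int: "integrable (?L \<Otimes>\<^sub>M ?M) (\<lambda>p. z j (fst p) (snd p))" if "j \<in> ?P" for j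
    unfolding z_def by (rule sq_weak_solution_integrable[OF sol_sq_weak_solution[OF that] tT])
  have z_T: "integrable ?M (z j (horizon G))" if "j \<in> ?P" for j
    unfolding z_def
    by (rule sq_weak_solution_marginal_integrable[OF sol_sq_weak_solution[OF that] T])
  have action_z: "(action_norm G (?A s \<omega>))\<^sup>2 \<le> (\<Sum>j\<in>?P. K j * (1 + z j s \<omega>))"
    if s: "s \<in> {t..horizon G}" and \<omega>: "\<omega> \<in> space ?M" for s \<omega>
    unfolding action_norm_power2
  proof (rule sum_mono)
    fix j assume j: "j \<in> ?P"
    have "sol G j t (x j) (\<phi> j) s \<omega> \<in> euc_set (sdim G j)"
      using measurable_space[OF sq_weak_solution_marginal_measurable
          [OF sol_sq_weak_solution[OF j] s] \<omega>] .
    with K[OF j] s t j show "(enorm (adim G j) (?A s \<omega> j))\<^sup>2 \<le> K j * (1 + z j s \<omega>)"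
      by (simp add: joint_control_def z_def)
  qed

  have f_bound: "\<bar>f (s, ?X s \<omega>, ?A s \<omega>)\<bar>
      \<le> \<bar>C\<bar> * (1 + (\<Sum>j\<in>?P. z j s \<omega>) + (\<Sum>j\<in>?P. K j * (1 + z j s \<omega>)))"
    if s: "s \<in> {t..horizon G}" and \<omega>: "\<omega> \<in> space ?M" for s \<omega>
  proof -
    let ?d = "1 + (state_norm G (?X s \<omega>))\<^sup>2 + (action_norm G (?A s \<omega>))\<^sup>2"
    have d: "0 < ?d" by (simp add: add_pos_nonneg)
    have "\<bar>f (s, ?X s \<omega>, ?A s \<omega>)\<bar> / ?d \<le> C"
      using s t by (intro C joint_state_control_in_space[OF s \<omega>]) auto
    then have "\<bar>f (s, ?X s \<omega>, ?A s \<omega>)\<bar> \<le> C * ?d"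
      using d by (simp add: pos_divide_le_eq)
    also have "\<dots> \<le> \<bar>C\<bar> * ?d"
      using d by (intro mult_right_mono) auto
    also have "\<dots> \<le> \<bar>C\<bar> * (1 + (\<Sum>j\<in>?P. z j s \<omega>) + (\<Sum>j\<in>?P. K j * (1 + z j s \<omega>)))"
      unfolding state_z using action_z[OF s \<omega>] by (intro mult_left_mono) auto
    finally show ?thesis .
  qed
  have f_int: "integrable (?L \<Otimes>\<^sub>M ?M) (\<lambda>p. f (fst p, ?X (fst p) (snd p), ?A (fst p) (snd p)))"
  proof (rule Bochner_Integration.integrable_bound)
    show "integrable (?L \<Otimes>\<^sub>M ?M) (\<lambda>p. \<bar>C\<bar> * (1 + (\<Sum>j\<in>?P. z j (fst p) (snd p))
        + (\<Sum>j\<in>?P. K j * (1 + z j (fst p) (snd p)))))"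
      by (intro integrable_mult_right Bochner_Integration.integrable_add
          Bochner_Integration.integrable_sum LM.integrable_const z_int)
    show "(\<lambda>p. f (fst p, ?X (fst p) (snd p), ?A (fst p) (snd p)))
        \<in> borel_measurable (?L \<Otimes>\<^sub>M ?M)"
      by (rule measurable_compose[OF measurable_Pair[OF fst_measurable_time
            measurable_Pair[OF joint_state_measurable joint_control_measurable]] f])
    show "AE p in ?L \<Otimes>\<^sub>M ?M. norm (f (fst p, ?X (fst p) (snd p), ?A (fst p) (snd p)))
        \<le> norm (\<bar>C\<bar> * (1 + (\<Sum>j\<in>?P. z j (fst p) (snd p))
          + (\<Sum>j\<in>?P. K j * (1 + z j (fst p) (snd p)))))"
    proof (rule AE_I2)
      fix p assume "p \<in> space (?L \<Otimes>\<^sub>M ?M)"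
      then have "fst p \<in> {t..horizon G}" "snd p \<in> space ?M"
        by (auto simp: space_pair_measure space_restrict_space)
      from order_trans[OF f_bound[OF this] abs_ge_self]
      show "norm (f (fst p, ?X (fst p) (snd p), ?A (fst p) (snd p)))
          \<le> norm (\<bar>C\<bar> * (1 + (\<Sum>j\<in>?P. z j (fst p) (snd p))
            + (\<Sum>j\<in>?P. K j * (1 + z j (fst p) (snd p)))))"
        by (simp only: real_norm_def)
    qed
  qed
  then have f_int': "integrable (?L \<Otimes>\<^sub>M ?M) (\<lambda>(s, \<omega>). f (s, ?X s \<omega>, ?A s \<omega>))"
    by (simp only: split_def)
  have g_int: "integrable ?M (\<lambda>\<omega>. g (?X (horizon G) \<omega>))"
  proof (rule Bochner_Integration.integrable_bound)
    show "integrable ?M (\<lambda>\<omega>. \<bar>D\<bar> * (1 + (\<Sum>j\<in>?P. z j (horizon G) \<omega>)))"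
      using z_T by simp
    have "(\<lambda>\<omega>. (horizon G, \<omega>)) \<in> ?M \<rightarrow>\<^sub>M ?L \<Otimes>\<^sub>M ?M"
      using T by (intro measurable_Pair1') (simp add: space_restrict_space)
    from measurable_compose[OF measurable_compose[OF this joint_state_measurable] g]
    show "(\<lambda>\<omega>. g (?X (horizon G) \<omega>)) \<in> borel_measurable ?M"
      by simp
    show "AE \<omega> in ?M. norm (g (?X (horizon G) \<omega>))
        \<le> norm (\<bar>D\<bar> * (1 + (\<Sum>j\<in>?P. z j (horizon G) \<omega>)))"
    proof (rule AE_I2)
      fix \<omega> assume \<omega>: "\<omega> \<in> space ?M"
      let ?d = "1 + (state_norm G (?X (horizon G) \<omega>))\<^sup>2"
      have d: "0 < ?d" by (simp add: add_pos_nonneg)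
      have "\<bar>g (?X (horizon G) \<omega>)\<bar> / ?d \<le> D"
        by (rule D[OF joint_state_control_in_space(1)[OF T \<omega>]])
      then have "\<bar>g (?X (horizon G) \<omega>)\<bar> \<le> D * ?d"
        using d by (simp add: pos_divide_le_eq)
      also have "\<dots> \<le> \<bar>D * ?d\<bar>" by (rule abs_ge_self)
      finally show "norm (g (?X (horizon G) \<omega>))
          \<le> norm (\<bar>D\<bar> * (1 + (\<Sum>j\<in>?P. z j (horizon G) \<omega>)))"
        by (simp add: abs_mult state_z)
    qed
  qed
  show ?thesis
    unfolding payoff_exists_def
  proof
    show "AE \<omega> in ?M. set_integrable lborel {t..horizon G} (\<lambda>s. f (s, ?X s \<omega>, ?A s \<omega>))"
      using AE_integrable_snd[OF f_int']
      by (simp add: integrable_restrict_space set_integrable_def)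
    show "integrable ?M (\<lambda>\<omega>. (LINT s:{t..horizon G}|lborel. f (s, ?X s \<omega>, ?A s \<omega>))
        + g (?X (horizon G) \<omega>))"
      using Bochner_Integration.integrable_add[OF integrable_snd[OF f_int'] g_int]
      by (simp add: integral_restrict_space set_lebesgue_integral_def)
  qed
qed

end

section \<open>Comparing payoffs\<close>

text \<open>The running gap \<open>f - f'\<close>, integrated over time, and the terminal gap \<open>g - g'\<close> may each lack an
  expectation while their sum has one, so the two stay together under the expectation. Their sum is
  measurable and integrable as a difference of two existing payoffs.\<close>

lemma payoff_diff_cong:
  assumes ex: "payoff_exists G f g t x \<phi>" "payoff_exists G f' g' t x \<phi>"
      "payoff_exists G f g t x \<psi>" "payoff_exists G f' g' t x \<psi>"
    and f: "\<And>s \<omega>. s \<in> {t..horizon G} \<Longrightarrow> \<omega> \<in> space (prb G) \<Longrightarrow>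
      f (s, joint_state G t x \<phi> s \<omega>, joint_control G t x \<phi> s \<omega>)
        - f' (s, joint_state G t x \<phi> s \<omega>, joint_control G t x \<phi> s \<omega>)
      = f (s, joint_state G t x \<psi> s \<omega>, joint_control G t x \<psi> s \<omega>)
        - f' (s, joint_state G t x \<psi> s \<omega>, joint_control G t x \<psi> s \<omega>)"
    and g: "\<And>\<omega>. \<omega> \<in> space (prb G) \<Longrightarrow>
      g (joint_state G t x \<phi> (horizon G) \<omega>) - g' (joint_state G t x \<phi> (horizon G) \<omega>)
      = g (joint_state G t x \<psi> (horizon G) \<omega>) - g' (joint_state G t x \<psi> (horizon G) \<omega>)"
  shows "payoff G f g t x \<phi> - payoff G f' g' t x \<phi> = payoff G f g t x \<psi> - payoff G f' g' t x \<psi>"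
proof -
  let ?T = "{t..horizon G}" and ?M = "prb G"
  define r where "r h \<theta> \<omega> s = h (s, joint_state G t x \<theta> s \<omega>, joint_control G t x \<theta> s \<omega>)"
    for h :: "real \<times> joint \<times> joint \<Rightarrow> real" and \<theta> \<omega> s
  define J where "J h k \<theta> \<omega> =
      (LINT s:?T|lborel. r h \<theta> \<omega> s) + k (joint_state G t x \<theta> (horizon G) \<omega>)"
    for h :: "real \<times> joint \<times> joint \<Rightarrow> real" and k :: "joint \<Rightarrow> real" and \<theta> \<omega>
  have payoff_J: "payoff G h k t x \<theta> = (LINT \<omega>|?M. J h k \<theta> \<omega>)" for h k \<theta>
    by (simp add: payoff_def J_def r_def)
  have int: "integrable ?M (J f g \<phi>)" "integrable ?M (J f' g' \<phi>)"
      "integrable ?M (J f g \<psi>)" "integrable ?M (J f' g' \<psi>)"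
    and AE_int: "AE \<omega> in ?M. set_integrable lborel ?T (r f \<phi> \<omega>)"
      "AE \<omega> in ?M. set_integrable lborel ?T (r f' \<phi> \<omega>)"
      "AE \<omega> in ?M. set_integrable lborel ?T (r f \<psi> \<omega>)"
      "AE \<omega> in ?M. set_integrable lborel ?T (r f' \<psi> \<omega>)"
    using ex by (simp_all add: payoff_exists_def J_def[abs_def] r_def[abs_def])
  have "AE \<omega> in ?M. J f g \<phi> \<omega> - J f' g' \<phi> \<omega> = J f g \<psi> \<omega> - J f' g' \<psi> \<omega>"
    using AE_int AE_space
  proof eventually_elim
    case (elim \<omega>)
    have "(LINT s:?T|lborel. r f \<phi> \<omega> s) - (LINT s:?T|lborel. r f' \<phi> \<omega> s)
        = (LINT s:?T|lborel. r f \<phi> \<omega> s - r f' \<phi> \<omega> s)"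
      using elim by (simp add: set_integral_diff)
    also have "\<dots> = (LINT s:?T|lborel. r f \<psi> \<omega> s - r f' \<psi> \<omega> s)"
      using f[OF _ elim(5)] by (intro set_lebesgue_integral_cong) (auto simp: r_def)
    also have "\<dots> = (LINT s:?T|lborel. r f \<psi> \<omega> s) - (LINT s:?T|lborel. r f' \<psi> \<omega> s)"
      using elim by (simp add: set_integral_diff)
    finally show ?case using g[OF elim(5)] by (simp add: J_def)
  qed
  then have "(LINT \<omega>|?M. J f g \<phi> \<omega> - J f' g' \<phi> \<omega>) = (LINT \<omega>|?M. J f g \<psi> \<omega> - J f' g' \<psi> \<omega>)"
    using int by (intro integral_cong_AE) auto
  then show ?thesis using int by (simp add: payoff_J)
qed

text \<open>Since player \<open>j\<close> reacts to its own state only, nobody else's trajectory moves when player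
  \<open>i\<close> changes policy.\<close>

lemma restrict_others_deviation:
  "restrict (joint_state G t x (\<psi>(i := \<phi>)) s \<omega>) (others G i)
    = restrict (joint_state G t x \<psi> s \<omega>) (others G i)"
  "restrict (joint_control G t x (\<psi>(i := \<phi>)) s \<omega>) (others G i)
    = restrict (joint_control G t x \<psi> s \<omega>) (others G i)"
  by (auto simp: joint_state_def joint_control_def others_def)

lemma profiles_deviation:
  assumes "i \<in> players G" "\<phi> \<in> policies G i" "\<psi> \<in> profiles G (others G i)"
  shows "\<psi>(i := \<phi>) \<in> profiles G (players G)"
proof -
  have "insert i (others G i) = players G"
    using assms(1) by (auto simp: others_def)
  with assms(2,3) show ?thesis
    unfolding profiles_def by (metis fun_upd_in_PiE PiE_fun_upd)
qed

theorem theorem3p1: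
  fixes G :: "'w dist_game"
    and Fp :: "real \<times> joint \<times> joint \<Rightarrow> real" and Gp :: "joint \<Rightarrow> real"
    and Uf :: "nat \<Rightarrow> real \<times> joint \<times> joint \<Rightarrow> real" and Ug :: "nat \<Rightarrow> joint \<Rightarrow> real"
  assumes game: "distributed_game G"
    and Fp_meas: "Fp \<in> borel_measurable
      (time (horizon G) \<Otimes>\<^sub>M states G (players G) \<Otimes>\<^sub>M actions G (players G))"
    and Gp_meas: "Gp \<in> borel_measurable (states G (players G))"
    and Uf_meas: "\<And>i. i \<in> players G \<Longrightarrow> Uf i \<in> borel_measurable
      (time (horizon G) \<Otimes>\<^sub>M states G (others G i) \<Otimes>\<^sub>M actions G (others G i))"
    and Ug_meas: "\<And>i. i \<in> players G \<Longrightarrow> Ug i \<in> borel_measurable (states G (others G i))"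
    and f_eq: "\<And>i t x a. i \<in> players G \<Longrightarrow> t \<in> {0..horizon G} \<Longrightarrow>
      x \<in> space (states G (players G)) \<Longrightarrow> a \<in> space (actions G (players G)) \<Longrightarrow>
      running G i (t, x, a) = Fp (t, x, a) + Uf i (t, restrict x (others G i), restrict a (others G i))"
    and g_eq: "\<And>i x. i \<in> players G \<Longrightarrow> x \<in> space (states G (players G)) \<Longrightarrow>
      terminal G i x = Gp x + Ug i (restrict x (others G i))"
    and Phi_exists: "\<And>t x \<phi>. t \<in> {0..horizon G} \<Longrightarrow> x \<in> space (states G (players G)) \<Longrightarrow>
      \<phi> \<in> profiles G (players G) \<Longrightarrow> payoff_exists G Fp Gp t x \<phi>"
  shows "markov_potential_game G (payoff G Fp Gp)"
  unfolding markov_potential_game_def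
proof (intro ballI)
  fix t x i \<phi> \<phi>' \<psi>
  assume t: "t \<in> {0..horizon G}" and x: "x \<in> space (states G (players G))"
    and i: "i \<in> players G" and \<phi>: "\<phi> \<in> policies G i" and \<phi>': "\<phi>' \<in> policies G i"
    and \<psi>: "\<psi> \<in> profiles G (others G i)"
  have T: "horizon G \<in> {t..horizon G}" using t by simp
  let ?f = "running G i" and ?g = "terminal G i"
  let ?X = "\<lambda>\<theta>. joint_state G t x (\<psi>(i := \<theta>))" and ?A = "\<lambda>\<theta>. joint_control G t x (\<psi>(i := \<theta>))"
  have ex_V: "payoff_exists G ?f ?g t x (\<psi>(i := \<theta>))" if "\<theta> \<in> policies G i" for \<theta>
    using game i unfolding distributed_game_def
    by (intro payoff_exists_of_quadratic_growth[OF game t x profiles_deviation[OF i that \<psi>]]) auto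
  have ex_Phi: "payoff_exists G Fp Gp t x (\<psi>(i := \<theta>))" if "\<theta> \<in> policies G i" for \<theta>
    by (rule Phi_exists[OF t x profiles_deviation[OF i that \<psi>]])
  have run: "?f (s, ?X \<theta> s \<omega>, ?A \<theta> s \<omega>) - Fp (s, ?X \<theta> s \<omega>, ?A \<theta> s \<omega>)
      = Uf i (s, restrict (joint_state G t x \<psi> s \<omega>) (others G i),
                 restrict (joint_control G t x \<psi> s \<omega>) (others G i))"
    if "\<theta> \<in> policies G i" and s: "s \<in> {t..horizon G}" and "\<omega> \<in> space (prb G)" for \<theta> s \<omega>
    using f_eq[OF i _ joint_state_control_in_space
        [OF game t x profiles_deviation[OF i that(1) \<psi>] that(2,3)], of s] s t
    by (simp add: restrict_others_deviation)
  have fin: "?g (?X \<theta> (horizon G) \<omega>) - Gp (?X \<theta> (horizon G) \<omega>)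
      = Ug i (restrict (joint_state G t x \<psi> (horizon G) \<omega>) (others G i))"
    if "\<theta> \<in> policies G i" and "\<omega> \<in> space (prb G)" for \<theta> \<omega>
    using g_eq[OF i joint_state_control_in_space(1)
        [OF game t x profiles_deviation[OF i that(1) \<psi>] T that(2)]]
    by (simp add: restrict_others_deviation)
  \<comment> \<open>The right-hand sides above do not mention the policy of player \<open>i\<close>.\<close>
  have "payoff G ?f ?g t x (\<psi>(i := \<phi>')) - payoff G Fp Gp t x (\<psi>(i := \<phi>'))
      = payoff G ?f ?g t x (\<psi>(i := \<phi>)) - payoff G Fp Gp t x (\<psi>(i := \<phi>))"
    by (rule payoff_diff_cong) (simp_all only: ex_V ex_Phi \<phi> \<phi>' run fin)
  then show "payoff G Fp Gp t x (\<psi>(i := \<phi>')) - payoff G Fp Gp t x (\<psi>(i := \<phi>))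
      = value_fun G i t x (\<psi>(i := \<phi>')) - value_fun G i t x (\<psi>(i := \<phi>))"
    by (simp add: value_fun_def)
qed

end
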